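(* Let $d\ge 1$ and $k\ge 1$ be integers. The set of $d$-minimal permutations of length $d+k$ is in bijection with the set of skew Young tableaux whose skew shapes $\lambda\setminus\mu$ satisfy $|\lambda\setminus\mu|=d+k$, have $k$ rows, and are such that any two consecutive rows have precisely two columns in common.
   Context: Permutations of length $n$ are bijections $\sigma$ of $\{1,\dots,n\}$, written as words $\sigma(1)\cdots\sigma(n)$. A descent of $\sigma$ is an index $i\in\{1,\dots,n-1\}$ with $\sigma(i)>\sigma(i+1)$. A permutation $\sigma$ is $d$-minimal (a minimal permutation with $d$ descents) if it is minimal, for the pattern-involvement order, for the property of having $d$ descents; in other words, $\sigma$ has exactly $d$ descents and, whenever any one of its entries is removed and the remaining entries are renamed order-isomorphically to $1,\dots,n-1$, the resulting permutation has $d-1$ descents. A Ferrers diagram of an integer partition $\lambda=(\lambda_1\ge\lambda_2\ge\cdots\ge\lambda_k>0)$ is the left-justified array of cells with $\lambda_i$ cells in row $i$, rows numbered from top to bottom. A skew shape $\lambda\setminus\mu$ is the set of cells of the Ferrers diagram of $\lambda$ not lying in the Ferrers diagram of $\mu$ (with $\mu\subseteq\lambda$, both diagrams aligned at the top-left corner; $\mu_i=0$ for $i>\ell(\mu)$); $|\lambda\setminus\mu|$ is its number of cells. Shapes are normalized so that the bottom row starts in the first column, i.e. $\mu_k=0$ where $k=\ell(\lambda)$ is the number of rows, and every row is nonempty. A skew Young tableau of shape $\lambda\setminus\mu$ with $n=|\lambda\setminus\mu|$ cells is a filling of its cells with the integers $1,\dots,n$, each used once, strictly decreasing along each row (left to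 right) and along each column (top to bottom). Two consecutive rows have precisely $h$ columns in common if exactly $h$ columns contain a cell of both rows. *)

theory Defs
  imports "HOL-Combinatorics.Multiset_Permutations" "HOL-Library.Sublist"
begin

(* Permutations are words sigma(1) ... sigma(n), i.e. lists; sigma(i) is the list
   entry with the 0-based index i - 1. *)

definition is_permutation :: "nat list \<Rightarrow> bool" where
  "is_permutation \<sigma> \<longleftrightarrow> \<sigma> \<in> permutations_of_set {1..length \<sigma>}"

definition descents :: "nat list \<Rightarrow> nat" where
  "descents xs = card {i. Suc i < length xs \<and> xs ! i > xs ! Suc i}"

(* For distinct entries, this is the order-isomorphic renaming to 1, ..., length xs. *)
definition standardize :: "nat list \<Rightarrow> nat list" where
  "standardize xs = map (\<lambda>x. card {y \<in> set xs. y \<le> x}) xs"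

definition pattern_of :: "nat list \<Rightarrow> nat list \<Rightarrow> bool" where
  "pattern_of \<pi> \<sigma> \<longleftrightarrow> (\<exists>ys. subseq ys \<sigma> \<and> \<pi> = standardize ys)"

definition d_minimal :: "nat \<Rightarrow> nat list \<Rightarrow> bool" where
  "d_minimal d \<sigma> \<longleftrightarrow> is_permutation \<sigma> \<and> descents \<sigma> = d \<and>
     (\<forall>\<pi>. is_permutation \<pi> \<and> pattern_of \<pi> \<sigma> \<and> \<pi> \<noteq> \<sigma> \<longrightarrow> descents \<pi> \<noteq> d)"

definition delete_entry :: "nat \<Rightarrow> nat list \<Rightarrow> nat list" where
  "delete_entry i xs = take i xs @ drop (Suc i) xs"

lemma descents_Nil [simp]: "descents [] = 0"
  and descents_single [simp]: "descents [x] = 0"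
  by (simp_all add: descents_def)

lemma descents_Cons_Cons [simp]:
  "descents (x # y # zs) = of_bool (x > y) + descents (y # zs)"
proof -
  let ?A = "{i. Suc i < length (y # zs) \<and> (y # zs) ! i > (y # zs) ! Suc i}"
  have eq: "{i. Suc i < length (x # y # zs) \<and> (x # y # zs) ! i > (x # y # zs) ! Suc i}
      = (if x > y then {0} else {}) \<union> Suc ` ?A" (is "?B = ?C")
  proof (rule set_eqI)
    fix i show "i \<in> ?B \<longleftrightarrow> i \<in> ?C" by (cases i) auto
  qed
  have fin: "finite ?A" by simp
  have "card ?C = of_bool (x > y) + card ?A"
    by (subst card_Un_disjoint) (auto simp: card_image fin)
  then show ?thesis unfolding descents_def eq by simp
qed

lemma descents_delete_one:
  "descents (xs @ ys) \<le> descents (xs @ a # ys)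
   \<and> descents (xs @ a # ys) \<le> Suc (descents (xs @ ys))"
proof (induction xs)
  case Nil
  then show ?case by (cases ys) auto
next
  case (Cons x xs)
  show ?case
  proof (cases xs)
    case Nil
    then show ?thesis by (cases ys) (auto simp: of_bool_def)
  next
    case (Cons x' xs')
    then show ?thesis using Cons.IH by auto
  qed
qed

lemma delete_entry_split:
  assumes "i < length xs"
  obtains us a vs where "xs = us @ a # vs" "delete_entry i xs = us @ vs"
  using assms id_take_nth_drop[OF assms] by (auto simp: delete_entry_def)

lemma descents_delete_entry:
  assumes "i < length xs"
  shows "descents (delete_entry i xs) \<le> descents xs"
    and "descents xs \<le> Suc (descents (delete_entry i xs))"
  using delete_entry_split[OF assms] descents_delete_one by metis+

lemma subseq_proper_delete_entry:
  assumes "subseq ys xs" "ys \<noteq> xs"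
  shows "\<exists>i<length xs. subseq ys (delete_entry i xs)"
  using assms
proof (induction rule: list_emb.induct)
  case (list_emb_Nil xs)
  then show ?case by (intro exI[of _ 0]) auto
next
  case (list_emb_Cons xs ys y)
  then show ?case by (intro exI[of _ 0]) (simp add: delete_entry_def)
next
  case (list_emb_Cons2 x y xs ys)
  then obtain i where "i < length ys" "subseq xs (delete_entry i ys)" by auto
  with list_emb_Cons2 show ?case
    by (intro exI[of _ "Suc i"]) (simp add: delete_entry_def)
qed

lemma descents_subseq: "subseq ys xs \<Longrightarrow> descents ys \<le> descents xs"
proof (induction "length xs" arbitrary: xs rule: less_induct)
  case less
  show ?case
  proof (cases "ys = xs")
    case False
    then obtain i where i: "i < length xs" "subseq ys (delete_entry i xs)"
      using subseq_proper_delete_entry less.prems by blast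
    have "length (delete_entry i xs) < length xs" using i(1) by (simp add: delete_entry_def)
    with less.hyps i(2) descents_delete_entry(1)[OF i(1)] show ?thesis by force
  qed simp
qed

lemma rank_less_iff:
  fixes A :: "nat set"
  assumes "finite A" "x \<in> A" "y \<in> A"
  shows "card {z \<in> A. z \<le> x} < card {z \<in> A. z \<le> y} \<longleftrightarrow> x < y"
proof -
  have *: "card {z \<in> A. z \<le> u} < card {z \<in> A. z \<le> v}" if "u < v" "v \<in> A" for u v
  proof (rule psubset_card_mono)
    have "v \<in> {z \<in> A. z \<le> v}" "v \<notin> {z \<in> A. z \<le> u}" using that by auto
    moreover have "{z \<in> A. z \<le> u} \<subseteq> {z \<in> A. z \<le> v}" using that by auto
    ultimately show "{z \<in> A. z \<le> u} \<subset> {z \<in> A. z \<le> v}" by blast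
  qed (use assms(1) in simp)
  show ?thesis using *[of x y] *[of y x] assms by (cases x y rule: linorder_cases) auto
qed

lemma length_standardize [simp]: "length (standardize xs) = length xs"
  by (simp add: standardize_def)

lemma descents_standardize: "descents (standardize xs) = descents xs"
proof -
  have "{i. Suc i < length xs \<and> standardize xs ! i > standardize xs ! Suc i}
      = {i. Suc i < length xs \<and> xs ! i > xs ! Suc i}"
    by (auto simp: standardize_def rank_less_iff)
  then show ?thesis by (simp add: descents_def)
qed

lemma is_permutation_standardize:
  assumes "distinct xs"
  shows "is_permutation (standardize xs)"
proof -
  let ?r = "\<lambda>x. card {y \<in> set xs. y \<le> x}"
  have inj: "inj_on ?r (set xs)"
  proof (rule inj_onI)
    fix x y assume "x \<in> set xs" "y \<in> set xs" "?r x = ?r y"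
    then show "x = y"
      using rank_less_iff[of "set xs" x y] rank_less_iff[of "set xs" y x] by auto
  qed
  have "?r x \<in> {1..length xs}" if "x \<in> set xs" for x
  proof -
    have "?r x \<le> card (set xs)" by (intro card_mono) auto
    moreover have "?r x > 0" using that by (subst card_gt_0_iff) auto
    ultimately show ?thesis using card_length[of xs] unfolding atLeastAtMost_iff by linarith
  qed
  then have "?r ` set xs \<subseteq> {1..length xs}" by auto
  moreover have "card (?r ` set xs) = length xs"
    using inj assms by (simp add: card_image distinct_card)
  ultimately have "?r ` set xs = {1..length xs}" by (intro card_subset_eq) auto
  then show ?thesis
    using assms inj by (simp add: is_permutation_def permutations_of_set_def standardize_def distinct_map)
qed

lemma standardize_permutation:
  assumes "is_permutation \<sigma>"
  shows "standardize \<sigma> = \<sigma>"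
  unfolding standardize_def
proof (rule map_idI)
  fix x assume "x \<in> set \<sigma>"
  moreover have s: "set \<sigma> = {1..length \<sigma>}"
    using assms by (simp add: is_permutation_def permutations_of_set_def)
  ultimately have "{y \<in> set \<sigma>. y \<le> x} = {1..x}" by auto
  then show "card {y \<in> set \<sigma>. y \<le> x} = x" by simp
qed

(* The one-entry-removal form of d-minimality; Suc avoids truncated subtraction. *)
lemma d_minimal_iff_delete_entry:
  "d_minimal d \<sigma> \<longleftrightarrow> is_permutation \<sigma> \<and> descents \<sigma> = d \<and>
     (\<forall>i<length \<sigma>. Suc (descents (standardize (delete_entry i \<sigma>))) = d)"
proof (intro iffI conjI allI impI)
  assume m: "d_minimal d \<sigma>"
  then show p: "is_permutation \<sigma>" and d: "descents \<sigma> = d" by (simp_all add: d_minimal_def)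
  fix i assume i: "i < length \<sigma>"
  let ?t = "delete_entry i \<sigma>"
  obtain us a vs where uv: "\<sigma> = us @ a # vs" "?t = us @ vs" using delete_entry_split[OF i] .
  have "distinct ?t"
    using p uv by (simp add: is_permutation_def permutations_of_set_def)
  moreover have "subseq (us @ vs) (us @ a # vs)" by (intro list_emb_append_mono) auto
  then have "subseq ?t \<sigma>" using uv by simp
  moreover have "standardize ?t \<noteq> \<sigma>"
  proof
    assume "standardize ?t = \<sigma>"
    then have "length ?t = length \<sigma>" using length_standardize[of ?t] by simp
    with i show False by (simp add: delete_entry_def)
  qed
  ultimately have "descents (standardize ?t) \<noteq> d"
    using m is_permutation_standardize unfolding d_minimal_def pattern_of_def by blast
  then show "Suc (descents (standardize ?t)) = d"
    using descents_delete_entry[OF i] d by (simp add: descents_standardize)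
next
  assume r: "is_permutation \<sigma> \<and> descents \<sigma> = d \<and>
     (\<forall>i<length \<sigma>. Suc (descents (standardize (delete_entry i \<sigma>))) = d)"
  have "descents \<pi> \<noteq> d" if "pattern_of \<pi> \<sigma>" and ne: "\<pi> \<noteq> \<sigma>" for \<pi>
  proof -
    obtain ys where ys: "subseq ys \<sigma>" "\<pi> = standardize ys"
      using \<open>pattern_of \<pi> \<sigma>\<close> by (auto simp: pattern_of_def)
    then have "ys \<noteq> \<sigma>" using ne r standardize_permutation by auto
    then obtain i where i: "i < length \<sigma>" "subseq ys (delete_entry i \<sigma>)"
      using subseq_proper_delete_entry ys(1) by blast
    then have "descents ys \<le> descents (delete_entry i \<sigma>)" using descents_subseq by blast
    moreover have "Suc (descents (delete_entry i \<sigma>)) = d"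
      using r i(1) by (simp add: descents_standardize)
    ultimately show ?thesis using ys(2) by (simp add: descents_standardize)
  qed
  with r show "d_minimal d \<sigma>" by (auto simp: d_minimal_def)
qed

definition is_partition :: "nat list \<Rightarrow> bool" where
  "is_partition xs \<longleftrightarrow> sorted_wrt (\<ge>) xs \<and> (\<forall>x\<in>set xs. x > 0)"

(* The 1-based part number i, which is 0 beyond the number of parts. *)
definition part :: "nat list \<Rightarrow> nat \<Rightarrow> nat" where
  "part xs i = (if 1 \<le> i \<and> i \<le> length xs then xs ! (i - 1) else 0)"

(* Cells are pairs (row, column), both counted from 1; row 1 is the top row. *)
definition ferrers :: "nat list \<Rightarrow> (nat \<times> nat) set" where
  "ferrers xs = {(i, j). 1 \<le> i \<and> 1 \<le> j \<and> j \<le> part xs i}"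

definition skew_cells :: "nat list \<Rightarrow> nat list \<Rightarrow> (nat \<times> nat) set" where
  "skew_cells lam mu = ferrers lam - ferrers mu"

definition skew_shape :: "nat list \<Rightarrow> nat list \<Rightarrow> bool" where
  "skew_shape lam mu \<longleftrightarrow> is_partition lam \<and> is_partition mu \<and> ferrers mu \<subseteq> ferrers lam
     \<and> part mu (length lam) = 0
     \<and> (\<forall>i\<in>{1..length lam}. \<exists>j. (i, j) \<in> skew_cells lam mu)"

definition common_columns :: "nat list \<Rightarrow> nat list \<Rightarrow> nat \<Rightarrow> nat" where
  "common_columns lam mu i =
     card {j. (i, j) \<in> skew_cells lam mu \<and> (Suc i, j) \<in> skew_cells lam mu}"

(* A filling is a partial map whose domain is the set of cells, so that fillings of
   different shapes are different. Since shapes are normalized with nonempty rows,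
   the cells determine lam and mu. *)
definition skew_tableau :: "nat list \<Rightarrow> nat list \<Rightarrow> (nat \<times> nat \<rightharpoonup> nat) \<Rightarrow> bool" where
  "skew_tableau lam mu T \<longleftrightarrow> skew_shape lam mu \<and> dom T = skew_cells lam mu
     \<and> bij_betw (\<lambda>c. the (T c)) (skew_cells lam mu) {1..card (skew_cells lam mu)}
     \<and> (\<forall>i j j'. (i, j) \<in> skew_cells lam mu \<and> (i, j') \<in> skew_cells lam mu \<and> j < j'
          \<longrightarrow> the (T (i, j)) > the (T (i, j')))
     \<and> (\<forall>i i' j. (i, j) \<in> skew_cells lam mu \<and> (i', j) \<in> skew_cells lam mu \<and> i < i'
          \<longrightarrow> the (T (i, j)) > the (T (i', j)))"

end

theory Submission imports Defs begin

text \<open>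
  Cut a permutation at its ascents into its maximal decreasing runs. A permutation of length
  \<open>d + k\<close> has \<open>d\<close> descents iff it has \<open>k\<close> runs. Deleting an entry loses a descent
  unless the entry sits in a particular position next to an ascent, and working this out shows
  that minimality is a local condition: around every ascent \<open>b < c\<close> there are four
  consecutive entries \<open>a > b < c > e\<close> with \<open>a < c\<close> and \<open>b < e\<close>
  (the patterns 2143 and 3142). This is lemma \<open>d_minimal_iff_tight_ascents\<close>.

  Now write the runs as the rows of an array, the first run at the bottom, and shift each row so
  that its first two entries \<open>c, e\<close> lie directly above the last two entries
  \<open>a, b\<close> of the row below. Rows decrease because they are runs, and the conditions
  \<open>a < c\<close>, \<open>b < e\<close> say precisely that the two common columns decrease downwards.
  So the \<open>d\<close>-minimal permutations are the bottom-to-top reading words of the tableaux in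
  question. Each new row starts two columns further left than its place in the word, hence the
  entry at position \<open>p\<close> of run \<open>a\<close>, both counted from 0, goes to row
  \<open>k - a\<close> and column \<open>p + 1 - 2 * a\<close>. Conversely a cell \<open>(i, j)\<close> determines its
  position \<open>j + 2 * (k - i) - 1\<close> without any reference to the shape, and the whole
  argument is carried out in terms of positions.

  The common datum of both sides is a function \<open>B\<close> giving the starting positions
  \<open>B 0 = 0 < B 1 < \<dots>\<close> of the rows, with \<open>B k\<close> the total length. Lemma
  \<open>d_minimal_iff_interlocked\<close> describes minimal permutations through \<open>B\<close>; lemmas
  \<open>skew_cells_eq_row_cells\<close> and \<open>skew_shape_of_row_bounds\<close> translate shapes into
  \<open>B\<close> and back; lemma \<open>skew_tableau_fill_iff\<close> translates the tableau conditions.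
  Finally \<open>B\<close> can be recovered from the word, so that the filling depends on the word only.
\<close>

section \<open>Deleting one entry and the local form of minimality\<close>

lemma is_permutation_iff_bij_betw:
  "is_permutation \<sigma> \<longleftrightarrow> bij_betw ((!) \<sigma>) {..<length \<sigma>} {1..length \<sigma>}"
proof
  assume "is_permutation \<sigma>"
  then show "bij_betw ((!) \<sigma>) {..<length \<sigma>} {1..length \<sigma>}"
    by (intro bij_betw_nth) (auto simp: is_permutation_def permutations_of_set_def)
next
  assume b: "bij_betw ((!) \<sigma>) {..<length \<sigma>} {1..length \<sigma>}"
  then have "set \<sigma> = {1..length \<sigma>}"
    by (auto simp: bij_betw_def set_conv_nth)
  moreover have "distinct \<sigma>"
    using b by (auto simp: bij_betw_def distinct_conv_nth inj_on_def)
  ultimately show "is_permutation \<sigma>"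
    by (simp add: is_permutation_def permutations_of_set_def)
qed

lemma is_permutation_distinct: "is_permutation \<sigma> \<Longrightarrow> distinct \<sigma>"
  by (simp add: is_permutation_def permutations_of_set_def)

lemma distinct_nth_Suc_less:
  fixes \<sigma> :: "nat list"
  assumes "distinct \<sigma>" "Suc i < length \<sigma>"
  shows "\<not> \<sigma> ! i < \<sigma> ! Suc i \<longleftrightarrow> \<sigma> ! Suc i < \<sigma> ! i"
  using nth_eq_iff_index_eq[OF assms(1), of i "Suc i"] assms(2) by (auto simp: not_less le_less)

text \<open>Only the two steps at the deleted entry and the new step closing the gap matter. The terms are
  arranged as a sum because subtraction on naturals truncates.\<close>

lemma descents_delete_middle:
  "descents (us @ x # a # y # vs) + of_bool (x > y)
    = descents (us @ x # y # vs) + of_bool (x > a) + of_bool (a > y)"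
proof (induction us)
  case (Cons u us)
  then show ?case by (cases us) auto
qed simp

lemma descents_delete_last:
  "descents (us @ [x, a]) = descents (us @ [x]) + of_bool (x > a)"
proof (induction us)
  case (Cons u us)
  then show ?case by (cases us) auto
qed simp

lemma descents_delete_entry_interior:
  assumes "Suc (Suc i) < length \<sigma>"
  shows "descents \<sigma> + of_bool (\<sigma> ! i > \<sigma> ! Suc (Suc i))
    = descents (delete_entry (Suc i) \<sigma>)
      + of_bool (\<sigma> ! i > \<sigma> ! Suc i) + of_bool (\<sigma> ! Suc i > \<sigma> ! Suc (Suc i))"
proof -
  have s: "\<sigma> = take i \<sigma> @ \<sigma> ! i # \<sigma> ! Suc i # \<sigma> ! Suc (Suc i) # drop (Suc (Suc (Suc i))) \<sigma>"
    using assms by (simp add: Cons_nth_drop_Suc)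
  have t: "delete_entry (Suc i) \<sigma>
      = take i \<sigma> @ \<sigma> ! i # \<sigma> ! Suc (Suc i) # drop (Suc (Suc (Suc i))) \<sigma>"
    using assms by (simp add: delete_entry_def take_Suc_conv_app_nth Cons_nth_drop_Suc)
  show ?thesis
    unfolding t by (subst s) (rule descents_delete_middle)
qed

lemma descents_delete_entry_first:
  assumes "1 < length \<sigma>"
  shows "descents \<sigma> = descents (delete_entry 0 \<sigma>) + of_bool (\<sigma> ! 0 > \<sigma> ! 1)"
proof -
  obtain x y zs where "\<sigma> = x # y # zs"
    using assms by (cases \<sigma> rule: remdups_adj.cases) auto
  then show ?thesis by (simp add: delete_entry_def)
qed

lemma descents_delete_entry_last:
  assumes "length \<sigma> = Suc (Suc i)"
  shows "descents \<sigma> = descents (delete_entry (Suc i) \<sigma>) + of_bool (\<sigma> ! i > \<sigma> ! Suc i)"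
proof -
  have s: "\<sigma> = take i \<sigma> @ [\<sigma> ! i, \<sigma> ! Suc i]"
    using assms id_take_nth_drop[of i \<sigma>] by (simp add: Cons_nth_drop_Suc flip: Cons_nth_drop_Suc)
  have t: "delete_entry (Suc i) \<sigma> = take i \<sigma> @ [\<sigma> ! i]"
    using assms by (simp add: delete_entry_def take_Suc_conv_app_nth)
  show ?thesis
    unfolding t by (subst s) (rule descents_delete_last)
qed

text \<open>For an ascent at \<open>i = Suc h\<close>, the four entries from index \<open>h\<close> on form the pattern
  2143 or 3142; in particular neither the first nor the last step of the word is an ascent.\<close>

definition tight_ascents :: "nat list \<Rightarrow> bool" where
  "tight_ascents \<sigma> \<longleftrightarrow> (\<forall>i. Suc i < length \<sigma> \<and> \<sigma> ! i < \<sigma> ! Suc i \<longrightarrow>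
     (\<exists>h. i = Suc h \<and> i + 2 < length \<sigma>
        \<and> \<sigma> ! Suc h < \<sigma> ! h \<and> \<sigma> ! (h + 3) < \<sigma> ! (h + 2)
        \<and> \<sigma> ! h < \<sigma> ! (h + 2) \<and> \<sigma> ! Suc h < \<sigma> ! (h + 3)))"

text \<open>An inner entry \<open>a\<close> between \<open>x\<close> and \<open>y\<close> costs exactly one descent if
  \<open>x > a > y\<close>, or if it is a peak or a valley and \<open>x < y\<close>. It costs none if
  \<open>x < a < y\<close> or if it is a peak or a valley and \<open>x > y\<close>. An end entry costs one iff
  its only step is a descent. So no two ascents are adjacent, no ascent is at an end, and the
  valley \<open>b\<close> and the peak \<open>c\<close> of an ascent give the inequalities \<open>a < c\<close>
  and \<open>b < e\<close>.\<close>

lemma every_deletion_loses_descent_iff: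
  assumes dist: "distinct \<sigma>" and len: "2 \<le> length \<sigma>"
  shows "(\<forall>i<length \<sigma>. Suc (descents (delete_entry i \<sigma>)) = descents \<sigma>) \<longleftrightarrow> tight_ascents \<sigma>"
    (is "(\<forall>i<_. ?P i) \<longleftrightarrow> _")
proof -
  have ne: "\<sigma> ! i \<noteq> \<sigma> ! j" if "i < length \<sigma>" "j < length \<sigma>" "i \<noteq> j" for i j
    using nth_eq_iff_index_eq[OF dist] that by blast
  have interior: "?P (Suc i) \<longleftrightarrow>
      (\<sigma> ! i > \<sigma> ! Suc i \<and> \<sigma> ! Suc i > \<sigma> ! Suc (Suc i)) \<or>
      ((\<sigma> ! i > \<sigma> ! Suc i \<or> \<sigma> ! Suc i > \<sigma> ! Suc (Suc i)) \<and> \<sigma> ! i < \<sigma> ! Suc (Suc i))"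
    if i: "Suc (Suc i) < length \<sigma>" for i
    using descents_delete_entry_interior[OF i] ne[of i "Suc i"] ne[of i "Suc (Suc i)"]
      ne[of "Suc i" "Suc (Suc i)"] i
    by (auto simp: of_bool_def split: if_splits)
  obtain m where m: "length \<sigma> = Suc (Suc m)"
    using len by (metis add_2_eq_Suc le_Suc_ex)
  have first: "?P 0 \<longleftrightarrow> \<sigma> ! 0 > \<sigma> ! 1"
    using descents_delete_entry_first[of \<sigma>] len by (auto simp: of_bool_def split: if_splits)
  have last: "?P (Suc m) \<longleftrightarrow> \<sigma> ! m > \<sigma> ! Suc m"
    using descents_delete_entry_last[OF m] by (auto simp: of_bool_def split: if_splits)
  show ?thesis
  proof
    assume all: "\<forall>i<length \<sigma>. ?P i"
    show "tight_ascents \<sigma>"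
      unfolding tight_ascents_def
    proof (intro allI impI)
      fix i assume i: "Suc i < length \<sigma> \<and> \<sigma> ! i < \<sigma> ! Suc i"
      have "\<sigma> ! 0 > \<sigma> ! 1" "\<sigma> ! m > \<sigma> ! Suc m"
        using all first last m by auto
      then have "i \<noteq> 0" using i by (metis One_nat_def not_less_iff_gr_or_eq)
      then obtain h where h: "i = Suc h" by (cases i) auto
      have "i \<noteq> m" using i \<open>\<sigma> ! m > \<sigma> ! Suc m\<close> by auto
      then have l: "Suc (Suc i) < length \<sigma>" using i m by auto
      have "?P (Suc h)" "?P (Suc (Suc h))" using all i h by auto
      then show "\<exists>h. i = Suc h \<and> i + 2 < length \<sigma>
        \<and> \<sigma> ! Suc h < \<sigma> ! h \<and> \<sigma> ! (h + 3) < \<sigma> ! (h + 2)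
        \<and> \<sigma> ! h < \<sigma> ! (h + 2) \<and> \<sigma> ! Suc h < \<sigma> ! (h + 3)"
        using interior[of h] interior[of "Suc h"] i l h
        by (auto simp: numeral_3_eq_3)
    qed
  next
    assume tight: "tight_ascents \<sigma>"
    have t: "\<exists>h. i = Suc h \<and> i + 2 < length \<sigma>
        \<and> \<sigma> ! Suc h < \<sigma> ! h \<and> \<sigma> ! (h + 3) < \<sigma> ! (h + 2)
        \<and> \<sigma> ! h < \<sigma> ! (h + 2) \<and> \<sigma> ! Suc h < \<sigma> ! (h + 3)"
      if "Suc i < length \<sigma>" "\<not> \<sigma> ! i > \<sigma> ! Suc i" for i
      using tight that distinct_nth_Suc_less[OF dist] unfolding tight_ascents_def by blast
    show "\<forall>i<length \<sigma>. ?P i"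
    proof (intro allI impI)
      fix i assume i: "i < length \<sigma>"
      consider "i = 0" | "i = Suc m" | h where "i = Suc h" "Suc (Suc h) < length \<sigma>"
        using i m by (metis Suc_less_eq less_Suc_eq not0_implies_Suc)
      then show "?P i"
      proof cases
        case 1
        then show ?thesis using first t[of 0] len by auto
      next
        case 2
        then show ?thesis using last t[of m] m by auto
      next
        case 3
        then show ?thesis
          using interior[of h] t[of h] t[of "Suc h"] by (fastforce simp: numeral_3_eq_3)
      qed
    qed
  qed
qed

lemma d_minimal_iff_tight_ascents:
  assumes "2 \<le> length \<sigma>"
  shows "d_minimal d \<sigma> \<longleftrightarrow> is_permutation \<sigma> \<and> descents \<sigma> = d \<and> tight_ascents \<sigma>"
  using every_deletion_loses_descent_iff[OF is_permutation_distinct assms]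
  unfolding d_minimal_iff_delete_entry descents_standardize by auto

section \<open>Starting positions of the decreasing runs\<close>

definition ascents_before :: "nat list \<Rightarrow> nat \<Rightarrow> nat" where
  "ascents_before \<sigma> p = card {i. i < p \<and> \<sigma> ! i < \<sigma> ! Suc i}"

lemma ascents_before_0 [simp]: "ascents_before \<sigma> 0 = 0"
  by (simp add: ascents_before_def)

lemma ascents_before_Suc:
  "ascents_before \<sigma> (Suc p) = ascents_before \<sigma> p + of_bool (\<sigma> ! p < \<sigma> ! Suc p)"
proof -
  have "{i. i < Suc p \<and> \<sigma> ! i < \<sigma> ! Suc i}
      = {i. i < p \<and> \<sigma> ! i < \<sigma> ! Suc i} \<union> (if \<sigma> ! p < \<sigma> ! Suc p then {p} else {})"
    by (auto simp: less_Suc_eq)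
  then show ?thesis by (simp add: ascents_before_def)
qed

lemma ascents_before_mono: "p \<le> q \<Longrightarrow> ascents_before \<sigma> p \<le> ascents_before \<sigma> q"
  unfolding ascents_before_def by (intro card_mono) auto

lemma descents_plus_ascents:
  assumes "distinct \<sigma>" "length \<sigma> = Suc m"
  shows "descents \<sigma> + ascents_before \<sigma> m = m"
proof -
  let ?D = "{i. Suc i < length \<sigma> \<and> \<sigma> ! i > \<sigma> ! Suc i}"
  let ?A = "{i. i < m \<and> \<sigma> ! i < \<sigma> ! Suc i}"
  have "card (?D \<union> ?A) = card ?D + card ?A"
    by (intro card_Un_disjoint finite_subset[of ?D "{..<length \<sigma>}"]) auto
  moreover have "?D \<union> ?A = {..<m}"
    using distinct_nth_Suc_less[OF assms(1)] assms(2) by auto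
  ultimately show ?thesis by (simp add: descents_def ascents_before_def)
qed

text \<open>The position \<open>p\<close> lies in the run with number \<open>ascents_before \<sigma> p\<close>, so this counts the
  entries of all runs before run \<open>a\<close>. As the run number is monotone in \<open>p\<close>, those
  entries form an initial segment and their number is the first position of run \<open>a\<close>.\<close>

definition run_start :: "nat list \<Rightarrow> nat \<Rightarrow> nat" where
  "run_start \<sigma> a = card {p. p < length \<sigma> \<and> ascents_before \<sigma> p < a}"

lemma less_run_start_iff:
  "p < run_start \<sigma> a \<longleftrightarrow> p < length \<sigma> \<and> ascents_before \<sigma> p < a"
proof -
  let ?S = "{p. p < length \<sigma> \<and> ascents_before \<sigma> p < a}"
  define m where "m = (LEAST x. x \<notin> ?S)"
  have ex: "length \<sigma> \<notin> ?S" by simp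
  have "m \<notin> ?S" unfolding m_def by (rule LeastI[of _ "length \<sigma>"]) (rule ex)
  have "?S = {..<m}"
  proof (rule set_eqI)
    fix x
    have "x \<in> ?S" if "x < m" using not_less_Least[of x "\<lambda>x. x \<notin> ?S"] that m_def by blast
    moreover have "x \<notin> ?S" if "m \<le> x"
      using \<open>m \<notin> ?S\<close> ascents_before_mono[OF that, of \<sigma>] that by auto
    ultimately show "x \<in> ?S \<longleftrightarrow> x \<in> {..<m}" using not_le by blast
  qed
  then have "run_start \<sigma> a = m" by (simp add: run_start_def)
  with \<open>?S = {..<m}\<close> show ?thesis by blast
qed

section \<open>Rows overlapping in two columns\<close>

text \<open>Row \<open>a\<close>, counted from 0 at the bottom, occupies the positions from \<open>B a\<close> to
  \<open>B (Suc a) - 1\<close>. A row has at least two entries since it shares two columns with a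
  neighbour; a single row has them because \<open>d \<ge> 1\<close>.\<close>

definition row_bounds :: "nat \<Rightarrow> (nat \<Rightarrow> nat) \<Rightarrow> bool" where
  "row_bounds k B \<longleftrightarrow> B 0 = 0 \<and> (\<forall>a<k. B a + 2 \<le> B (Suc a))"

definition in_row :: "nat \<Rightarrow> (nat \<Rightarrow> nat) \<Rightarrow> nat \<Rightarrow> nat \<Rightarrow> bool" where
  "in_row k B a p \<longleftrightarrow> a < k \<and> B a \<le> p \<and> p < B (Suc a)"

text \<open>Positions \<open>p\<close> and \<open>p + 2\<close> in adjacent rows are exactly the pairs of vertically
  adjacent cells, so these are the row and column conditions of a tableau for neighbouring cells.\<close>

definition interlocked :: "nat \<Rightarrow> (nat \<Rightarrow> nat) \<Rightarrow> nat list \<Rightarrow> bool" where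
  "interlocked k B \<sigma> \<longleftrightarrow>
     (\<forall>a p. in_row k B a p \<and> in_row k B a (Suc p) \<longrightarrow> \<sigma> ! Suc p < \<sigma> ! p) \<and>
     (\<forall>a p. in_row k B a p \<and> in_row k B (Suc a) (p + 2) \<longrightarrow> \<sigma> ! p < \<sigma> ! (p + 2))"

lemma row_bounds_gap:
  assumes "row_bounds k B" "a \<le> b" "b \<le> k"
  shows "B a + 2 * (b - a) \<le> B b"
  using assms(2,3)
proof (induction b rule: dec_induct)
  case (step b)
  then have "B b + 2 \<le> B (Suc b)" using assms(1) by (simp add: row_bounds_def)
  with step show ?case by (simp add: Suc_diff_le)
qed simp

lemma in_row_exists:
  assumes "row_bounds k B" "p < B k"
  shows "\<exists>a. in_row k B a p"
proof -
  define b where "b = (LEAST b. p < B b)"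
  have b: "p < B b" unfolding b_def by (rule LeastI) (rule assms)
  have "b \<le> k" unfolding b_def by (rule Least_le) (rule assms)
  have "b \<noteq> 0" using b assms by (metis row_bounds_def not_less_zero)
  then obtain a where a: "b = Suc a" by (cases b) auto
  then have "\<not> p < B a" using not_less_Least[of a "\<lambda>b. p < B b"] b_def by simp
  with a b \<open>b \<le> k\<close> show ?thesis by (intro exI[of _ a]) (simp add: in_row_def)
qed

lemma in_row_unique:
  assumes "row_bounds k B" "in_row k B a p" "in_row k B b p"
  shows "a = b"
proof -
  have *: "\<not> a < b" if "in_row k B a p" "in_row k B b p" for a b
    using row_bounds_gap[OF assms(1), of "Suc a" b] that by (auto simp: in_row_def)
  show ?thesis using *[of a b] *[of b a] assms by auto
qed

lemma in_row_less: "row_bounds k B \<Longrightarrow> in_row k B a p \<Longrightarrow> p < B k"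
  using row_bounds_gap[of k B "Suc a" k] by (auto simp: in_row_def)

lemma in_row_ge: "row_bounds k B \<Longrightarrow> in_row k B a p \<Longrightarrow> 2 * a \<le> p"
  using row_bounds_gap[of k B 0 a] by (auto simp: in_row_def row_bounds_def)



lemma interlocked_row_decreasing:
  assumes "interlocked k B \<sigma>" "in_row k B a p" "in_row k B a q" "p < q"
  shows "\<sigma> ! q < \<sigma> ! p"
  using assms(4,3)
proof (induction q)
  case (Suc q)
  show ?case
  proof (cases "p = q")
    case True
    then show ?thesis using assms(1,2) Suc.prems by (auto simp: interlocked_def)
  next
    case False
    then have q: "p < q" "in_row k B a q"
      using Suc.prems assms(2) by (auto simp: in_row_def)
    have "\<sigma> ! Suc q < \<sigma> ! q"
      using assms(1) q(2) Suc.prems(2) unfolding interlocked_def by blast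
    also have "\<dots> < \<sigma> ! p" using Suc.IH q by blast
    finally show ?thesis .
  qed
qed simp

text \<open>A column may pass through several rows of length two. Every row between two cells of a
  column also meets that column, so the inequalities between adjacent rows can be chained.\<close>

lemma interlocked_column_increasing:
  assumes "row_bounds k B" "interlocked k B \<sigma>"
    and "in_row k B a p" "in_row k B (a + m) (p + 2 * m)" "0 < m"
  shows "\<sigma> ! p < \<sigma> ! (p + 2 * m)"
  using assms(3-)
proof (induction m arbitrary: a p)
  case (Suc m)
  \<comment> \<open>If \<open>p + 2\<close> were still in row \<open>a\<close>, then, all rows having length at least 2,
    the position \<open>p + 2 * Suc m\<close> would come before the start of row \<open>a + Suc m\<close>.\<close>
  have next_row: "in_row k B (Suc a) (p + 2)"
  proof -
    have "Suc a < k" using Suc.prems by (simp add: in_row_def)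
    then have "B (Suc a) + 2 \<le> B (Suc (Suc a))" using assms(1) by (simp add: row_bounds_def)
    moreover have "B (Suc a) + 2 * m \<le> B (Suc a + m)"
      using row_bounds_gap[OF assms(1), of "Suc a" "Suc a + m"] Suc.prems(2)
      by (simp add: in_row_def)
    ultimately show ?thesis using Suc.prems \<open>Suc a < k\<close> by (simp add: in_row_def)
  qed
  have step: "\<sigma> ! p < \<sigma> ! (p + 2)"
    using assms(2) Suc.prems(1) next_row unfolding interlocked_def by blast
  show ?case
  proof (cases "m = 0")
    case True
    then show ?thesis using step by simp
  next
    case False
    have "\<sigma> ! (p + 2) < \<sigma> ! (p + 2 + 2 * m)"
      using Suc.IH[OF next_row] Suc.prems(2) False by simp
    with step show ?thesis by simp
  qed
qed simp

section \<open>Minimal permutations as interlocked words\<close>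

text \<open>A run starts at the beginning of the word or right after an ascent, and in both cases the
  local condition makes the next step a descent. This is why runs have length at least two.\<close>

lemma tight_ascents_imp_row_bounds:
  assumes tight: "tight_ascents \<sigma>"
    and len: "2 \<le> length \<sigma>" and asc: "ascents_before \<sigma> (length \<sigma> - 1) = k - 1" and k: "1 \<le> k"
  shows "row_bounds k (run_start \<sigma>)" "run_start \<sigma> k = length \<sigma>"
proof -
  let ?n = "length \<sigma>"
  have ascent: "\<exists>h. i = Suc h \<and> i + 2 < length \<sigma>
        \<and> \<sigma> ! Suc h < \<sigma> ! h \<and> \<sigma> ! (h + 3) < \<sigma> ! (h + 2)
        \<and> \<sigma> ! h < \<sigma> ! (h + 2) \<and> \<sigma> ! Suc h < \<sigma> ! (h + 3)"
    if "Suc i < length \<sigma>" "\<sigma> ! i < \<sigma> ! Suc i" for i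
    using tight that unfolding tight_ascents_def by blast
  have "ascents_before \<sigma> p \<le> k - 1" if "p < ?n" for p
    using ascents_before_mono[of p "?n - 1" \<sigma>] asc that by simp
  then have "p < run_start \<sigma> k \<longleftrightarrow> p < ?n" for p
    using k by (force simp: less_run_start_iff)
  then show "run_start \<sigma> k = ?n" by (metis linorder_neqE_nat less_irrefl)
  have zero: "run_start \<sigma> 0 = 0" by (simp add: run_start_def)
  have "run_start \<sigma> a + 2 \<le> run_start \<sigma> (Suc a)" if a: "a < k" for a
  proof -
    define b where "b = run_start \<sigma> a"
    have "\<not> ascents_before \<sigma> (?n - 1) < a" unfolding asc using a by simp
    then have "\<not> ?n - 1 < b" unfolding b_def less_run_start_iff by blast
    then have b: "b < ?n" using len by simp
    have "ascents_before \<sigma> (Suc b) \<le> a \<and> Suc b < ?n"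
    proof (cases b)
      case 0
      have "\<not> \<sigma> ! 0 < \<sigma> ! Suc 0" using ascent[of 0] len by auto
      then show ?thesis using 0 len by (simp add: ascents_before_Suc)
    next
      case (Suc c)
      have "c < run_start \<sigma> a" "\<not> b < run_start \<sigma> a" using Suc by (auto simp: b_def)
      then have c: "ascents_before \<sigma> c < a" "\<not> ascents_before \<sigma> (Suc c) < a"
        using b Suc by (auto simp: less_run_start_iff)
      then have up: "\<sigma> ! c < \<sigma> ! Suc c" "ascents_before \<sigma> b = a"
        using Suc by (auto simp: ascents_before_Suc of_bool_def split: if_splits)
      then have "Suc b < ?n \<and> \<not> \<sigma> ! b < \<sigma> ! Suc b"
        using ascent[of c] b Suc by (auto simp: numeral_3_eq_3)
      with up show ?thesis by (simp add: ascents_before_Suc)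
    qed
    then have "Suc b < run_start \<sigma> (Suc a)" by (simp add: less_run_start_iff)
    then show ?thesis by (simp add: b_def)
  qed
  with zero show "row_bounds k (run_start \<sigma>)" by (simp add: row_bounds_def)
qed

lemma tight_ascents_imp_interlocked:
  assumes dist: "distinct \<sigma>" and tight: "tight_ascents \<sigma>"
  shows "interlocked k (run_start \<sigma>) \<sigma>"
proof -
  have asc: "p < length \<sigma> \<and> ascents_before \<sigma> p = a" if "in_row k (run_start \<sigma>) a p" for a p
    using that unfolding in_row_def not_less[symmetric] less_run_start_iff by auto
  have "\<sigma> ! Suc p < \<sigma> ! p"
    if "in_row k (run_start \<sigma>) a p" "in_row k (run_start \<sigma>) a (Suc p)" for a p
    using asc[OF that(1)] asc[OF that(2)] distinct_nth_Suc_less[OF dist, of p]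
    by (auto simp: ascents_before_Suc)
  moreover have "\<sigma> ! p < \<sigma> ! (p + 2)"
    if "in_row k (run_start \<sigma>) a p" "in_row k (run_start \<sigma>) (Suc a) (p + 2)" for a p
  proof -
    have n: "p + 2 < length \<sigma>" using asc[OF that(2)] by simp
    \<comment> \<open>The run number rises between \<open>p\<close> and \<open>p + 2\<close>, so one of the two steps is an
      ascent; \<open>p\<close> is its second or its first window entry, respectively.\<close>
    have "\<sigma> ! p < \<sigma> ! Suc p \<or> \<sigma> ! Suc p < \<sigma> ! Suc (Suc p)"
      using asc[OF that(1)] asc[OF that(2)]
      by (auto simp: ascents_before_Suc of_bool_def split: if_splits)
    moreover have "\<sigma> ! p < \<sigma> ! (p + 2)" if up: "\<sigma> ! p < \<sigma> ! Suc p"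
    proof -
      have "Suc p < length \<sigma>" using n by simp
      then obtain h where "p = Suc h" "\<sigma> ! Suc h < \<sigma> ! (h + 3)"
        using tight up unfolding tight_ascents_def by blast
      then show ?thesis by (simp add: numeral_3_eq_3)
    qed
    moreover have "\<sigma> ! p < \<sigma> ! (p + 2)" if up: "\<sigma> ! Suc p < \<sigma> ! Suc (Suc p)"
    proof -
      have "Suc (Suc p) < length \<sigma>" using n by simp
      then obtain h where "Suc p = Suc h" "\<sigma> ! h < \<sigma> ! (h + 2)"
        using tight up unfolding tight_ascents_def by blast
      then show ?thesis by simp
    qed
    ultimately show ?thesis by blast
  qed
  ultimately show ?thesis unfolding interlocked_def by blast
qed

text \<open>The last two entries of a row and the first two of the next one form the window of a tight
  ascent: the rows give its two descents and the common columns the other two inequalities.\<close>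

lemma ascent_at_row_end:
  assumes B: "row_bounds k B" and il: "interlocked k B \<sigma>"
    and p: "in_row k B a p" "\<not> in_row k B a (Suc p)" "Suc p < B k"
  obtains h where "p = Suc h" "p + 2 < B k" "in_row k B (Suc a) (Suc p)"
    "\<sigma> ! Suc h < \<sigma> ! h" "\<sigma> ! (h + 3) < \<sigma> ! (h + 2)"
    "\<sigma> ! h < \<sigma> ! (h + 2)" "\<sigma> ! Suc h < \<sigma> ! (h + 3)"
proof -
  have e: "B (Suc a) = Suc p" "a < k" using p by (auto simp: in_row_def)
  then have a: "Suc a < k" using p(3) by (metis Suc_lessI less_irrefl)
  have g: "B a + 2 \<le> B (Suc a)" "B (Suc a) + 2 \<le> B (Suc (Suc a))"
    using B a by (auto simp: row_bounds_def)
  then obtain h where h: "p = Suc h" using e by (cases p) auto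
  have rows: "in_row k B a h" "in_row k B a (Suc h)"
    "in_row k B (Suc a) (h + 2)" "in_row k B (Suc a) (Suc (h + 2))" "in_row k B (Suc a) (Suc h + 2)"
    using e a g h by (auto simp: in_row_def)
  have "\<sigma> ! Suc h < \<sigma> ! h" "\<sigma> ! Suc (h + 2) < \<sigma> ! (h + 2)"
    "\<sigma> ! h < \<sigma> ! (h + 2)" "\<sigma> ! Suc h < \<sigma> ! (Suc h + 2)"
    using il rows unfolding interlocked_def by blast+
  moreover have "p + 2 < B k" using in_row_less[OF B rows(4)] h by simp
  ultimately show ?thesis using that[OF h] rows h by (simp add: numeral_3_eq_3)
qed

text \<open>There are no ascents inside a row, and there is one at each junction.\<close>

lemma interlocked_ascents_before:
  assumes B: "row_bounds k B" and il: "interlocked k B \<sigma>"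
  shows "in_row k B a p \<Longrightarrow> ascents_before \<sigma> p = a"
proof (induction p arbitrary: a)
  case 0
  then show ?case using in_row_ge[OF B 0] by simp
next
  case (Suc p)
  have less: "Suc p < B k" using in_row_less[OF B Suc.prems] .
  then obtain b where b: "in_row k B b p" using in_row_exists[OF B, of p] by auto
  show ?case
  proof (cases "in_row k B b (Suc p)")
    case True
    then have "\<sigma> ! Suc p < \<sigma> ! p" using il b by (auto simp: interlocked_def)
    moreover have "a = b" using in_row_unique[OF B Suc.prems True] .
    ultimately show ?thesis using Suc.IH[OF b] by (simp add: ascents_before_Suc)
  next
    case False
    obtain h where h: "p = Suc h" "in_row k B (Suc b) (Suc p)"
      "\<sigma> ! (h + 3) < \<sigma> ! (h + 2)" "\<sigma> ! Suc h < \<sigma> ! (h + 3)"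
      using ascent_at_row_end[OF B il b False less] by metis
    have "a = Suc b" using in_row_unique[OF B Suc.prems h(2)] .
    moreover have "\<sigma> ! p < \<sigma> ! Suc p" using h by simp
    ultimately show ?thesis using Suc.IH[OF b] by (simp add: ascents_before_Suc)
  qed
qed

lemma interlocked_imp_tight_ascents:
  assumes B: "row_bounds k B" and il: "interlocked k B \<sigma>" and len: "B k = length \<sigma>"
  shows "tight_ascents \<sigma>"
  unfolding tight_ascents_def
proof (intro allI impI)
  fix i assume i: "Suc i < length \<sigma> \<and> \<sigma> ! i < \<sigma> ! Suc i"
  then obtain a where a: "in_row k B a i" using in_row_exists[OF B, of i] len by auto
  have n: "\<not> in_row k B a (Suc i)" using il a i unfolding interlocked_def by (meson less_asym)
  show "\<exists>h. i = Suc h \<and> i + 2 < length \<sigma>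
        \<and> \<sigma> ! Suc h < \<sigma> ! h \<and> \<sigma> ! (h + 3) < \<sigma> ! (h + 2)
        \<and> \<sigma> ! h < \<sigma> ! (h + 2) \<and> \<sigma> ! Suc h < \<sigma> ! (h + 3)"
    using ascent_at_row_end[OF B il a n] i len by metis
qed

text \<open>The row bounds are determined by the word alone. This makes the tableau of a word a function
  of the word.\<close>

lemma interlocked_run_start:
  assumes B: "row_bounds k B" and il: "interlocked k B \<sigma>" and len: "B k = length \<sigma>" and a: "a \<le> k"
  shows "run_start \<sigma> a = B a"
proof -
  have "p < run_start \<sigma> a \<longleftrightarrow> p < B a" for p
  proof (cases "p < length \<sigma>")
    case True
    then obtain b where b: "in_row k B b p" using in_row_exists[OF B] len by auto
    have "p < B a \<longleftrightarrow> b < a"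
      using row_bounds_gap[OF B, of "Suc b" a] row_bounds_gap[OF B, of a b] b a
      by (cases "b < a") (auto simp: in_row_def)
    then show ?thesis
      using True interlocked_ascents_before[OF B il b] by (simp add: less_run_start_iff)
  next
    case False
    then show ?thesis using row_bounds_gap[OF B a] len by (simp add: less_run_start_iff)
  qed
  then show ?thesis by (metis linorder_neqE_nat less_irrefl)
qed

lemma d_minimal_iff_interlocked:
  assumes "1 \<le> d" "1 \<le> k" "length \<sigma> = d + k"
  shows "d_minimal d \<sigma> \<longleftrightarrow> is_permutation \<sigma> \<and>
    (\<exists>B. row_bounds k B \<and> B k = length \<sigma> \<and> interlocked k B \<sigma>)"
proof -
  have len: "2 \<le> length \<sigma>" and m: "length \<sigma> = Suc (d + k - 1)" using assms by auto
  show ?thesis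
    unfolding d_minimal_iff_tight_ascents[OF len]
  proof (intro iffI conjI; (elim conjE exE)?)
    assume p: "is_permutation \<sigma>" and d: "descents \<sigma> = d" and t: "tight_ascents \<sigma>"
    have "ascents_before \<sigma> (length \<sigma> - 1) = k - 1"
      using descents_plus_ascents[OF is_permutation_distinct[OF p] m] d assms by simp
    then show "\<exists>B. row_bounds k B \<and> B k = length \<sigma> \<and> interlocked k B \<sigma>"
      using tight_ascents_imp_row_bounds[OF t len]
        tight_ascents_imp_interlocked[OF is_permutation_distinct[OF p] t] assms(2) by blast
  next
    fix B assume p: "is_permutation \<sigma>"
      and B: "row_bounds k B" "B k = length \<sigma>" "interlocked k B \<sigma>"
    show "tight_ascents \<sigma>" using interlocked_imp_tight_ascents[OF B(1,3,2)] .
    have "B (k - 1) + 2 \<le> B k"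
      using B(1) assms(2) unfolding row_bounds_def
      by (metis One_nat_def Suc_pred less_eq_Suc_le lessI)
    then have "in_row k B (k - 1) (d + k - 1)"
      using B(2) assms by (auto simp: in_row_def)
    then have "ascents_before \<sigma> (d + k - 1) = k - 1"
      by (rule interlocked_ascents_before[OF B(1,3)])
    then show "descents \<sigma> = d"
      using descents_plus_ascents[OF is_permutation_distinct[OF p] m] assms by simp
  qed auto
qed

section \<open>Cells, positions and fillings\<close>

text \<open>The reading position of a cell of a shape with \<open>k\<close> rows, rows being read from bottom to
  top: each step up moves the row two columns to the left of where its word position would put it.\<close>

definition position :: "nat \<Rightarrow> nat \<times> nat \<Rightarrow> nat" where
  "position k c = snd c + 2 * (k - fst c) - 1"

definition row_cells :: "nat \<Rightarrow> (nat \<Rightarrow> nat) \<Rightarrow> (nat \<times> nat) set" where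
  "row_cells k B = {(i, j). 1 \<le> i \<and> i \<le> k \<and> 1 \<le> j \<and> in_row k B (k - i) (position k (i, j))}"

definition fill :: "nat \<Rightarrow> (nat \<Rightarrow> nat) \<Rightarrow> nat list \<Rightarrow> (nat \<times> nat \<rightharpoonup> nat)" where
  "fill k B \<sigma> c = (if c \<in> row_cells k B then Some (\<sigma> ! position k c) else None)"

lemma dom_fill: "dom (fill k B \<sigma>) = row_cells k B"
  by (auto simp: fill_def dom_def)

lemma row_cells_of_position:
  assumes "row_bounds k B" "in_row k B a p"
  shows "(k - a, Suc p - 2 * a) \<in> row_cells k B" "position k (k - a, Suc p - 2 * a) = p"
proof -
  have "2 * a \<le> p" "a < k" using in_row_ge[OF assms] assms(2) by (auto simp: in_row_def)
  then show "position k (k - a, Suc p - 2 * a) = p" by (simp add: position_def)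
  with \<open>2 * a \<le> p\<close> \<open>a < k\<close> assms(2) show "(k - a, Suc p - 2 * a) \<in> row_cells k B"
    by (auto simp: row_cells_def Suc_le_eq)
qed

lemma bij_betw_position:
  assumes "row_bounds k B"
  shows "bij_betw (position k) (row_cells k B) {..<B k}"
  unfolding bij_betw_def
proof
  show "inj_on (position k) (row_cells k B)"
  proof (rule inj_onI, clarify)
    fix i j i' j'
    assume c: "(i, j) \<in> row_cells k B" "(i', j') \<in> row_cells k B"
      and e: "position k (i, j) = position k (i', j')"
    then have "k - i = k - i'"
      using in_row_unique[OF assms] by (auto simp: row_cells_def)
    with c e show "i = i' \<and> j = j'" by (auto simp: row_cells_def position_def)
  qed
  have "position k c < B k" if "c \<in> row_cells k B" for c
    using that in_row_less[OF assms] by (auto simp: row_cells_def)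
  moreover have "p \<in> position k ` row_cells k B" if "p < B k" for p
    using in_row_exists[OF assms that] row_cells_of_position[OF assms] by (metis image_eqI)
  ultimately show "position k ` row_cells k B = {..<B k}" by auto
qed

text \<open>Positions are a bijection from the cells to the indices of the word, so bijectivity of the
  filling is that of the word. The monotonicity conditions for neighbouring cells are literally
  those on the word, and they imply the conditions for cells at a distance.\<close>

lemma skew_tableau_fill_iff:
  assumes B: "row_bounds k B" and shape: "skew_shape lam mu" "skew_cells lam mu = row_cells k B"
    and len: "length \<sigma> = B k"
  shows "skew_tableau lam mu (fill k B \<sigma>) \<longleftrightarrow> is_permutation \<sigma> \<and> interlocked k B \<sigma>"
proof -
  note pos = bij_betw_position[OF B]
  let ?R = "row_cells k B"
  have card: "card ?R = B k" using bij_betw_same_card[OF pos] by simp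
  have val: "the (fill k B \<sigma> c) = \<sigma> ! position k c" if "c \<in> ?R" for c
    using that by (simp add: fill_def)
  have "bij_betw (\<lambda>c. the (fill k B \<sigma> c)) ?R {1..card ?R}
      \<longleftrightarrow> bij_betw ((!) \<sigma> \<circ> position k) ?R {1..card ?R}"
    by (rule bij_betw_cong) (simp add: val)
  also have "\<dots> \<longleftrightarrow> is_permutation \<sigma>"
    using bij_betw_comp_iff[OF pos, of "(!) \<sigma>" "{1..B k}"] by (simp add: is_permutation_iff_bij_betw len card)
  finally have bij: "bij_betw (\<lambda>c. the (fill k B \<sigma> c)) ?R {1..card ?R} \<longleftrightarrow> is_permutation \<sigma>" .
  let ?rows = "\<forall>i j j'. (i, j) \<in> ?R \<and> (i, j') \<in> ?R \<and> j < j'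
          \<longrightarrow> the (fill k B \<sigma> (i, j)) > the (fill k B \<sigma> (i, j'))"
  let ?cols = "\<forall>i i' j. (i, j) \<in> ?R \<and> (i', j) \<in> ?R \<and> i < i'
          \<longrightarrow> the (fill k B \<sigma> (i, j)) > the (fill k B \<sigma> (i', j))"
  have "?rows \<and> ?cols \<longleftrightarrow> interlocked k B \<sigma>"
  proof
    assume mono: "?rows \<and> ?cols"
    show "interlocked k B \<sigma>"
      unfolding interlocked_def
    proof (intro conjI allI impI; elim conjE)
      fix a p assume r: "in_row k B a p" "in_row k B a (Suc p)"
      note c = row_cells_of_position[OF B r(1)] row_cells_of_position[OF B r(2)]
      have "Suc p - 2 * a < Suc (Suc p) - 2 * a" using in_row_ge[OF B r(1)] by simp
      with mono c(1,3) have "the (fill k B \<sigma> (k - a, Suc (Suc p) - 2 * a))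
          < the (fill k B \<sigma> (k - a, Suc p - 2 * a))" by blast
      then show "\<sigma> ! Suc p < \<sigma> ! p" using c by (simp add: val)
    next
      fix a p assume r: "in_row k B a p" "in_row k B (Suc a) (p + 2)"
      note c = row_cells_of_position[OF B r(1)] row_cells_of_position[OF B r(2)]
      have e: "Suc (p + 2) - 2 * Suc a = Suc p - 2 * a" by simp
      have "k - Suc a < k - a" using r(1) by (auto simp: in_row_def)
      with mono c(1,3) have "the (fill k B \<sigma> (k - a, Suc p - 2 * a))
          < the (fill k B \<sigma> (k - Suc a, Suc p - 2 * a))" unfolding e by blast
      then show "\<sigma> ! p < \<sigma> ! (p + 2)" using c unfolding e by (simp add: val)
    qed
  next
    assume il: "interlocked k B \<sigma>"
    show "?rows \<and> ?cols"
    proof (intro conjI allI impI; elim conjE)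
      fix i j j' assume c: "(i, j) \<in> ?R" "(i, j') \<in> ?R" "j < j'"
      then have "position k (i, j) < position k (i, j')" by (auto simp: row_cells_def position_def)
      then have "\<sigma> ! position k (i, j') < \<sigma> ! position k (i, j)"
        using interlocked_row_decreasing[OF il] c by (auto simp: row_cells_def)
      then show "the (fill k B \<sigma> (i, j')) < the (fill k B \<sigma> (i, j))" using c by (simp add: val)
    next
      fix i i' j assume c: "(i, j) \<in> ?R" "(i', j) \<in> ?R" "i < i'"
      have e: "position k (i, j) = position k (i', j) + 2 * (i' - i)" "k - i = k - i' + (i' - i)"
        using c by (auto simp: row_cells_def position_def)
      have "\<sigma> ! position k (i', j) < \<sigma> ! (position k (i', j) + 2 * (i' - i))"
        using interlocked_column_increasing[OF B il, of "k - i'" "position k (i', j)" "i' - i"] c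
        unfolding e[symmetric] by (simp add: row_cells_def)
      then show "the (fill k B \<sigma> (i', j)) < the (fill k B \<sigma> (i, j))"
        using c unfolding e(1)[symmetric] by (simp add: val)
    qed
  qed
  with bij shape show ?thesis
    unfolding skew_tableau_def by (simp add: dom_fill)
qed

section \<open>Skew shapes with two common columns\<close>

lemma part_antimono:
  assumes "sorted_wrt (\<ge>) xs" "1 \<le> i" "i \<le> i'"
  shows "part xs i' \<le> part xs i"
proof (cases "i = i'")
  case False
  then show ?thesis
    using sorted_wrt_nth_less[OF assms(1), of "i - 1" "i' - 1"] assms by (auto simp: part_def)
qed simp

lemma mem_skew_cells:
  "(i, j) \<in> skew_cells lam mu \<longleftrightarrow> 1 \<le> i \<and> part mu i < j \<and> j \<le> part lam i"
  by (auto simp: skew_cells_def ferrers_def)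

lemma ferrers_subset_iff: "ferrers mu \<subseteq> ferrers lam \<longleftrightarrow> (\<forall>i. part mu i \<le> part lam i)"
proof
  assume sub: "ferrers mu \<subseteq> ferrers lam"
  show "\<forall>i. part mu i \<le> part lam i"
  proof
    fix i
    show "part mu i \<le> part lam i"
    proof (cases "part mu i = 0")
      case False
      then have "(i, part mu i) \<in> ferrers mu" by (auto simp: ferrers_def part_def split: if_splits)
      then show ?thesis using sub by (auto simp: ferrers_def)
    qed simp
  qed
next
  assume "\<forall>i. part mu i \<le> part lam i"
  then show "ferrers mu \<subseteq> ferrers lam" by (auto simp: ferrers_def intro: order_trans)
qed

text \<open>Both rows are intervals of columns, and the lower one neither starts nor ends further right.
  So the common columns run from the start of the upper row to the end of the lower one.\<close>

lemma common_columns_eq: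
  assumes "is_partition lam" "is_partition mu" "1 \<le> i"
  shows "common_columns lam mu i = part lam (Suc i) - part mu i"
proof -
  have "{j. (i, j) \<in> skew_cells lam mu \<and> (Suc i, j) \<in> skew_cells lam mu}
      = {part mu i<..part lam (Suc i)}"
    using part_antimono[of lam i "Suc i"] part_antimono[of mu i "Suc i"] assms
    by (auto simp: mem_skew_cells is_partition_def)
  then show ?thesis by (simp add: common_columns_def)
qed

text \<open>Two common columns mean \<open>\<lambda>\<^sub>i\<^sub>+\<^sub>1 = \<mu>\<^sub>i + 2\<close>, so the positions of row \<open>i\<close> begin exactly
  where those of the row below end. For a single row there is no neighbour to force length two;
  there the number of cells is needed.\<close>

lemma skew_cells_eq_row_cells:
  assumes shape: "skew_shape lam mu" and len: "length lam = k" and k: "1 \<le> k"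
    and card: "Suc k \<le> card (skew_cells lam mu)"
    and common: "\<forall>i\<in>{1..<k}. common_columns lam mu i = 2"
  shows "\<exists>B. row_bounds k B \<and> skew_cells lam mu = row_cells k B"
proof -
  have parts: "is_partition lam" "is_partition mu" and mu0: "part mu k = 0"
    using shape len by (auto simp: skew_shape_def)
  \<comment> \<open>The last bound ends the top row, which has no row above it whose start could serve.\<close>
  define B where "B a = (if a < k then part mu (k - a) + 2 * a else part lam 1 + 2 * (k - 1))" for a
  have overlap: "part lam (Suc i) = part mu i + 2" if "1 \<le> i" "i < k" for i
    using common that common_columns_eq[OF parts that(1)] by auto
  have B_low: "B (k - i) = part mu i + 2 * (k - i)" if "1 \<le> i" "i \<le> k" for i
    using that by (simp add: B_def)
  have B_high: "B (Suc (k - i)) = part lam i + 2 * (k - i)" if i: "1 \<le> i" "i \<le> k" for i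
  proof (cases "i = 1")
    case False
    then have "part lam i = part mu (i - 1) + 2" using overlap[of "i - 1"] i by simp
    moreover have "k - Suc (k - i) = i - 1" "Suc (k - i) < k" using i False by auto
    ultimately show ?thesis by (simp add: B_def)
  qed (use k in \<open>simp add: B_def\<close>)
  have two: "part mu i + 2 \<le> part lam i" if i: "1 \<le> i" "i \<le> k" for i
  proof -
    consider "1 < i" | "i = 1" "1 < k" | "i = 1" "k = 1" using i by linarith
    then show ?thesis
    proof cases
      case 1
      then have "part lam i = part mu (i - 1) + 2" using overlap[of "i - 1"] i by simp
      with 1 show ?thesis
        using part_antimono[of mu "i - 1" i] parts by (simp add: is_partition_def)
    next
      case 2
      then show ?thesis
        using overlap[of 1] part_antimono[of lam 1 2] parts
        by (simp add: is_partition_def numeral_2_eq_2)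
    next
      case 3
      have "skew_cells lam mu = {1} \<times> {1..part lam 1}"
        using mu0 3 len by (auto simp: mem_skew_cells part_def split: if_splits)
      then show ?thesis using card 3 mu0 by (simp add: card_cartesian_product)
    qed
  qed
  have "B a + 2 \<le> B (Suc a)" if "a < k" for a
    using B_low[of "k - a"] B_high[of "k - a"] two[of "k - a"] that by simp
  moreover have "B 0 = 0" using k mu0 by (simp add: B_def)
  ultimately have "row_bounds k B" by (simp add: row_bounds_def)
  moreover have "(i, j) \<in> skew_cells lam mu \<longleftrightarrow> (i, j) \<in> row_cells k B" for i j
  proof (cases "1 \<le> i \<and> i \<le> k")
    case True
    define m where "m = k - i"
    have "B m = part mu i + 2 * m" "B (Suc m) = part lam i + 2 * m" "m < k"
      using True B_low[of i] B_high[of i] by (auto simp: m_def)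
    with True show ?thesis
      by (auto simp: mem_skew_cells row_cells_def in_row_def position_def simp flip: m_def)
  next
    case False
    then show ?thesis by (auto simp: mem_skew_cells row_cells_def part_def len)
  qed
  ultimately show ?thesis by auto
qed

lemma part_takeWhile_pos:
  assumes "sorted_wrt (\<ge>) xs"
  shows "part (takeWhile (\<lambda>x. 0 < x) xs) i = part xs i"
proof -
  let ?ys = "takeWhile (\<lambda>x. 0 < x) xs"
  have le: "length ?ys \<le> length xs" by (rule length_takeWhile_le)
  show ?thesis
  proof (cases "length ?ys < i \<and> i \<le> length xs")
    case True
    then have "xs ! length ?ys = 0" using nth_length_takeWhile[of "\<lambda>x. 0 < x" xs] by auto
    moreover have "part xs i \<le> part xs (Suc (length ?ys))"
      using part_antimono[OF assms] True by simp
    ultimately show ?thesis using True by (simp add: part_def)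
  next
    case False
    then show ?thesis using le by (auto simp: part_def takeWhile_nth)
  qed
qed

text \<open>Row \<open>i\<close> of \<open>\<lambda>\<close> and of \<open>\<mu>\<close> is the end and the start of the corresponding
  positions, shifted by \<open>2 * (k - i)\<close>. Since rows have length at least two, the shifted bounds
  are still weakly monotone. A partition has no zero parts, so the zeros at the end of the second
  list have to be cut off; lemma \<open>part_takeWhile_pos\<close> says that this leaves the parts
  unchanged.\<close>

lemma skew_shape_of_row_bounds:
  assumes B: "row_bounds k B" and k: "1 \<le> k"
  shows "\<exists>lam mu. skew_shape lam mu \<and> length lam = k \<and> skew_cells lam mu = row_cells k B
    \<and> (\<forall>i\<in>{1..<k}. common_columns lam mu i = 2)"
proof -
  define lam where "lam = map (\<lambda>i. B (Suc (k - Suc i)) - 2 * (k - Suc i)) [0..<k]"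
  define ms where "ms = map (\<lambda>i. B (k - Suc i) - 2 * (k - Suc i)) [0..<k]"
  define mu where "mu = takeWhile (\<lambda>x. 0 < x) ms"
  have len: "length lam = k" by (simp add: lam_def)
  have gap: "B a + 2 * (b - a) \<le> B b" if "a \<le> b" "b \<le> k" for a b
    using row_bounds_gap[OF B that] .
  have low: "2 * a \<le> B a" if "a \<le> k" for a
    using gap[of 0 a] that B by (simp add: row_bounds_def)
  have high_mono: "B (Suc a) - 2 * a \<le> B (Suc b) - 2 * b" if "a \<le> b" "b < k" for a b
  proof -
    obtain c where c: "b = a + c" using \<open>a \<le> b\<close> le_Suc_ex by blast
    show ?thesis using gap[of "Suc a" "Suc b"] \<open>b < k\<close> unfolding c by simp
  qed
  have low_mono: "B a - 2 * a \<le> B b - 2 * b" if "a \<le> b" "b \<le> k" for a b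
  proof -
    obtain c where c: "b = a + c" using \<open>a \<le> b\<close> le_Suc_ex by blast
    show ?thesis using gap[of a b] \<open>b \<le> k\<close> unfolding c by simp
  qed
  have sorted_lam: "sorted_wrt (\<ge>) lam"
    by (auto simp: sorted_wrt_iff_nth_less lam_def intro: high_mono)
  have sorted_ms: "sorted_wrt (\<ge>) ms"
    by (auto simp: sorted_wrt_iff_nth_less ms_def intro: low_mono)
  have part_lam: "part lam i = B (Suc (k - i)) - 2 * (k - i)" if "1 \<le> i" "i \<le> k" for i
    using that by (cases i) (simp_all add: part_def lam_def)
  have part_mu: "part mu i = (if 1 \<le> i \<and> i \<le> k then B (k - i) - 2 * (k - i) else 0)" for i
    using part_takeWhile_pos[OF sorted_ms, of i] by (auto simp: mu_def part_def ms_def)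
  have two: "part mu i + 2 \<le> part lam i" if "1 \<le> i" "i \<le> k" for i
  proof -
    define m where "m = k - i"
    have m: "m < k" "part mu i = B m - 2 * m" "part lam i = B (Suc m) - 2 * m"
      using that part_mu[of i] part_lam[of i] by (auto simp: m_def)
    then show ?thesis using gap[of m "Suc m"] low[of m] by simp
  qed
  have lam: "is_partition lam"
    unfolding is_partition_def
  proof (intro conjI ballI sorted_lam)
    fix x assume "x \<in> set lam"
    then obtain i where "i < k" "x = lam ! i" using len by (auto simp: in_set_conv_nth)
    then show "0 < x" using two[of "Suc i"] len by (simp add: part_def)
  qed
  have "sorted_wrt (\<ge>) mu" unfolding mu_def by (rule sorted_wrt_takeWhile) (rule sorted_ms)
  then have mu: "is_partition mu"
    by (auto simp: is_partition_def mu_def dest: set_takeWhileD)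
  have "part mu i \<le> part lam i" for i
    using two[of i] part_mu[of i] by (cases "1 \<le> i \<and> i \<le> k") auto
  moreover have "part mu k = 0" using part_mu[of k] B by (simp add: row_bounds_def)
  moreover have "(i, part lam i) \<in> skew_cells lam mu" if "i \<in> {1..k}" for i
    using two[of i] that by (simp add: mem_skew_cells)
  ultimately have shape: "skew_shape lam mu"
    using lam mu unfolding skew_shape_def ferrers_subset_iff len by blast
  have "(i, j) \<in> skew_cells lam mu \<longleftrightarrow> (i, j) \<in> row_cells k B" for i j
  proof (cases "1 \<le> i \<and> i \<le> k")
    case True
    define m where "m = k - i"
    have "part mu i = B m - 2 * m" "part lam i = B (Suc m) - 2 * m" "m < k" "2 * m \<le> B m"
      using True low[of "k - i"] part_mu[of i] part_lam[of i] by (auto simp: m_def)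
    with True show ?thesis
      by (auto simp: mem_skew_cells row_cells_def in_row_def position_def simp flip: m_def)
  next
    case False
    then show ?thesis by (auto simp: mem_skew_cells row_cells_def part_def len)
  qed
  then have cells: "skew_cells lam mu = row_cells k B" by auto
  have "common_columns lam mu i = 2" if "i \<in> {1..<k}" for i
  proof -
    define m where "m = k - Suc i"
    have m: "k - i = Suc m" "Suc m \<le> k" "i < k" "1 \<le> i" using that by (auto simp: m_def)
    then have "part lam (Suc i) = B (Suc m) - 2 * m" "part mu i = B (Suc m) - 2 * Suc m"
      using part_lam[of "Suc i"] part_mu[of i] by (simp_all add: m_def)
    then show ?thesis
      using low[of "Suc m"] common_columns_eq[OF lam mu m(4)] m(2) by simp
  qed
  with shape len cells show ?thesis by blast
qed

section \<open>The bijection\<close>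

text \<open>The position of a cell depends on the cell and \<open>k\<close> only, so the word is read off from the
  filling without knowing the row bounds.\<close>

lemma fill_inject:
  assumes "row_bounds k B" "length \<sigma> = B k" "row_bounds k B'" "length \<tau> = B' k"
    and eq: "fill k B \<sigma> = fill k B' \<tau>"
  shows "\<sigma> = \<tau>"
proof -
  have cells: "row_cells k B = row_cells k B'" using dom_fill eq by metis
  note pos = bij_betw_position[OF assms(1)] bij_betw_position[OF assms(3)]
  have "B k = B' k" using bij_betw_same_card[OF pos(1)] bij_betw_same_card[OF pos(2)] cells by simp
  moreover have "\<sigma> ! p = \<tau> ! p" if "p < B k" for p
  proof -
    have "p \<in> position k ` row_cells k B" using pos(1) that by (simp add: bij_betw_def)
    then obtain c where c: "c \<in> row_cells k B" "position k c = p" by blast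
    have "fill k B \<sigma> c = fill k B' \<tau> c" by (simp only: eq)
    with c cells show ?thesis by (simp add: fill_def)
  qed
  ultimately show ?thesis using assms(2,4) by (intro nth_equalityI) simp_all
qed

lemma fill_surj:
  assumes B: "row_bounds k B" and dom: "dom T = row_cells k B"
  shows "\<exists>\<sigma>. length \<sigma> = B k \<and> T = fill k B \<sigma>"
proof -
  note pos = bij_betw_position[OF B]
  define \<sigma> where "\<sigma> = map (\<lambda>p. the (T (inv_into (row_cells k B) (position k) p))) [0..<B k]"
  have "T c = fill k B \<sigma> c" for c
  proof (cases "c \<in> row_cells k B")
    case True
    then have "position k c < B k" using pos by (auto simp: bij_betw_def)
    moreover have "inv_into (row_cells k B) (position k) (position k c) = c"
      using True pos by (simp add: bij_betw_def)
    moreover have "T c \<noteq> None" using True dom by blast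
    ultimately show ?thesis using True by (auto simp: fill_def \<sigma>_def)
  next
    case False
    then show ?thesis using dom by (auto simp: fill_def)
  qed
  then have "T = fill k B \<sigma>" by (rule ext)
  moreover have "length \<sigma> = B k" by (simp add: \<sigma>_def)
  ultimately show ?thesis by blast
qed

lemma fill_cong:
  assumes "\<And>a. a \<le> k \<Longrightarrow> B a = B' a"
  shows "fill k B \<sigma> = fill k B' \<sigma>"
proof -
  have "in_row k B a p \<longleftrightarrow> in_row k B' a p" for a p
    using assms by (auto simp: in_row_def)
  then show ?thesis by (simp add: fill_def row_cells_def fun_eq_iff)
qed

theorem proposition3p1:
  fixes d k :: nat
  assumes "d \<ge> 1" and "k \<ge> 1"
  shows "\<exists>f. bij_betw f
    {\<sigma>. d_minimal d \<sigma> \<and> length \<sigma> = d + k}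
    {T. \<exists>lam mu. skew_tableau lam mu T \<and> card (skew_cells lam mu) = d + k
          \<and> length lam = k \<and> (\<forall>i\<in>{1..<k}. common_columns lam mu i = 2)}"
    (is "\<exists>f. bij_betw f ?M ?T")
proof (intro exI)
  let ?f = "\<lambda>\<sigma>. fill k (run_start \<sigma>) \<sigma>"
  have runs: "is_permutation \<sigma> \<and> row_bounds k (run_start \<sigma>) \<and> run_start \<sigma> k = d + k
      \<and> interlocked k (run_start \<sigma>) \<sigma>" if "\<sigma> \<in> ?M" for \<sigma>
  proof -
    from that have len: "length \<sigma> = d + k" by simp
    from that obtain B where p: "is_permutation \<sigma>"
      and B: "row_bounds k B" "B k = length \<sigma>" "interlocked k B \<sigma>"
      using d_minimal_iff_interlocked[OF assms] by blast
    have eq: "run_start \<sigma> a = B a" if "a \<le> k" for a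
      using interlocked_run_start[OF B(1,3,2) that] .
    then have "in_row k (run_start \<sigma>) = in_row k B" by (auto simp: in_row_def fun_eq_iff)
    with p B len eq show ?thesis by (simp add: row_bounds_def interlocked_def)
  qed
  show "bij_betw ?f ?M ?T"
    unfolding bij_betw_def
  proof
    show "inj_on ?f ?M"
    proof (rule inj_onI)
      fix \<sigma> \<tau> assume "\<sigma> \<in> ?M" "\<tau> \<in> ?M" "?f \<sigma> = ?f \<tau>"
      then show "\<sigma> = \<tau>"
        using fill_inject[of k "run_start \<sigma>" \<sigma> "run_start \<tau>" \<tau>] runs[of \<sigma>] runs[of \<tau>]
        by simp
    qed
    have "?f \<sigma> \<in> ?T" if "\<sigma> \<in> ?M" for \<sigma>
    proof -
      note r = runs[OF that]
      obtain lam mu where s: "skew_shape lam mu" "length lam = k"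
        "skew_cells lam mu = row_cells k (run_start \<sigma>)"
        "\<forall>i\<in>{1..<k}. common_columns lam mu i = 2"
        using skew_shape_of_row_bounds r assms(2) by blast
      have "skew_tableau lam mu (?f \<sigma>)"
        using skew_tableau_fill_iff[OF _ s(1,3)] r that by auto
      moreover have "card (skew_cells lam mu) = d + k"
        using bij_betw_same_card[OF bij_betw_position] r s(3) by fastforce
      ultimately show ?thesis using s by blast
    qed
    moreover have "T \<in> ?f ` ?M" if "T \<in> ?T" for T
    proof -
      obtain lam mu where t: "skew_tableau lam mu T" "card (skew_cells lam mu) = d + k"
        "length lam = k" "\<forall>i\<in>{1..<k}. common_columns lam mu i = 2"
        using \<open>T \<in> ?T\<close> by blast
      then have shape: "skew_shape lam mu" and dom: "dom T = skew_cells lam mu"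
        by (auto simp: skew_tableau_def)
      obtain B where B: "row_bounds k B" and cells: "skew_cells lam mu = row_cells k B"
        using skew_cells_eq_row_cells[OF shape t(3) assms(2) _ t(4)] t(2) assms by auto
      obtain \<sigma> where \<sigma>: "length \<sigma> = B k" "T = fill k B \<sigma>"
        using fill_surj[OF B, of T] dom cells by auto
      have n: "B k = d + k"
        using bij_betw_same_card[OF bij_betw_position[OF B]] cells t(2) by simp
      have il: "is_permutation \<sigma>" "interlocked k B \<sigma>"
        using skew_tableau_fill_iff[OF B shape cells \<sigma>(1)] t(1) \<sigma>(2) by auto
      then have "\<sigma> \<in> ?M"
        using d_minimal_iff_interlocked[OF assms, of \<sigma>] B \<sigma>(1) n by auto
      moreover have "T = ?f \<sigma>"
        unfolding \<sigma>(2) using interlocked_run_start[OF B il(2)] \<sigma>(1) by (intro fill_cong) simp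
      ultimately show ?thesis by blast
    qed
    ultimately show "?f ` ?M = ?T" by blast
  qed
qed

end
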